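(* For each of the following properties there exist Baire 1 functions $f:\mathbb{R}\to\mathbb{R}$ having that property, yet not continuous in the ordinary sense: (1) $f$ is graph continuous. (2) $f$ is symmetric. (3) $f$ is locally almost quasicontinuous.
   Context: All topological notions refer to the usual topology. $f:\mathbb{R}\to\mathbb{R}$ is Baire 1 if it is the pointwise limit of a sequence of continuous functions $\mathbb{R}\to\mathbb{R}$. $f$ is graph continuous if the closure (in $\mathbb{R}^2$) of its graph contains the graph of a continuous function $\mathbb{R}\to\mathbb{R}$. $f$ is symmetric at $x$ if $\lim_{h\to0}\bigl(f(x+h)+f(x-h)-2f(x)\bigr)=0$, and symmetric if it is symmetric at every $x\in\mathbb{R}$. $f$ is locally almost quasicontinuous if for every $x\in\mathbb{R}$ and every neighborhood $V$ of $f(x)$ one has $x\in\overline{\operatorname{Int}(\overline{f^{-1}(V)})}$. *)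

theory Defs
  imports "HOL-Analysis.Analysis"
begin

definition baire_one :: "(real \<Rightarrow> real) \<Rightarrow> bool" where
  "baire_one f \<longleftrightarrow>
     (\<exists>g :: nat \<Rightarrow> real \<Rightarrow> real.
        (\<forall>n. continuous_on UNIV (g n)) \<and> (\<forall>x. (\<lambda>n. g n x) \<longlonglongrightarrow> f x))"

definition fun_graph :: "(real \<Rightarrow> real) \<Rightarrow> (real \<times> real) set" where
  "fun_graph f = {(x, f x) | x. True}"

definition graph_continuous :: "(real \<Rightarrow> real) \<Rightarrow> bool" where
  "graph_continuous f \<longleftrightarrow>
     (\<exists>g :: real \<Rightarrow> real. continuous_on UNIV g \<and> fun_graph g \<subseteq> closure (fun_graph f))"

definition symmetric_at :: "(real \<Rightarrow> real) \<Rightarrow> real \<Rightarrow> bool" where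
  "symmetric_at f x \<longleftrightarrow> ((\<lambda>h. f (x + h) + f (x - h) - 2 * f x) \<longlongrightarrow> 0) (at 0)"

definition symmetric_fun :: "(real \<Rightarrow> real) \<Rightarrow> bool" where
  "symmetric_fun f \<longleftrightarrow> (\<forall>x. symmetric_at f x)"

(* Neighborhoods are not required to be open: V is a neighborhood of y iff y \<in> interior V. *)
definition locally_almost_quasicontinuous :: "(real \<Rightarrow> real) \<Rightarrow> bool" where
  "locally_almost_quasicontinuous f \<longleftrightarrow>
     (\<forall>x V. f x \<in> interior V \<longrightarrow> x \<in> closure (interior (closure (f -` V))))"

end

theory Submission
  imports Defs
begin

text \<open>
  A single jump already separates the three properties from continuity. Take a function that is
  constant on each of the two open half lines, with values \<open>a\<close> on the left, \<open>b\<close> at the origin and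
  \<open>c\<close> on the right. Such a function is always Baire 1, since each of the two jumps is a pointwise
  limit of steeper and steeper ramps, and it is discontinuous as soon as \<open>a \<noteq> b\<close>. Each property
  becomes one equation between the three values that is compatible with \<open>a \<noteq> b\<close>:

  \<^item> graph continuity follows from \<open>a = c\<close>, because the closure of the graph fills in the point
    that is missing from the horizontal line at height \<open>a\<close> (witness: the indicator of the origin);
  \<^item> symmetry follows from \<open>a + c = 2 b\<close>, because the jumps on the two sides then cancel
    (witness: the sign function);
  \<^item> local almost quasicontinuity follows from \<open>b = c\<close>, because the origin is a boundary point
    of the open half line on which the value at the origin is taken (witness: the Heaviside
    function).
\<close>

definition step :: "real \<Rightarrow> real \<Rightarrow> real \<Rightarrow> real \<Rightarrow> real" where
  "step a b c x = (if x < 0 then a else if x = 0 then b else c)"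

text \<open>
  The jump from \<open>a\<close> to \<open>b\<close> is climbed by a ramp on \<open>[-1/n, 0]\<close>, the jump from \<open>b\<close> to \<open>c\<close> by a ramp
  on \<open>[0, 1/n]\<close>. At every point the approximations are eventually equal to the limit.
\<close>

lemma baire_one_step: "baire_one (step a b c)"
  unfolding baire_one_def
proof (intro exI conjI allI)
  let ?ramp = "\<lambda>t::real. max 0 (min 1 t)"
  let ?g = "\<lambda>(n::nat) x. a + (b - a) * ?ramp (1 + real n * x) + (c - b) * ?ramp (real n * x)"
  show "continuous_on UNIV (?g n)" for n
    by (intro continuous_intros)
  fix x :: real
  have "\<forall>\<^sub>F n in sequentially. ?g n x = step a b c x"
  proof (cases "x = 0")
    case True
    then show ?thesis by (simp add: step_def)
  next
    case False
    obtain N :: nat where N: "1 / \<bar>x\<bar> < real N"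
      using reals_Archimedean2 by blast
    have "?g n x = step a b c x" if "n \<ge> N" for n
    proof -
      have "1 / \<bar>x\<bar> < real n" using N that by linarith
      then have large: "1 < real n * \<bar>x\<bar>"
        using False by (simp add: field_simps)
      show ?thesis
      proof (cases "x < 0")
        case True
        then have "1 + real n * x \<le> 0" "real n * x \<le> 0" using large by simp_all
        then show ?thesis using True by (simp add: step_def)
      next
        case nonneg: False
        then have "1 \<le> 1 + real n * x" "1 \<le> real n * x" using large by simp_all
        then show ?thesis using nonneg False by (simp add: step_def)
      qed
    qed
    then show ?thesis by (auto simp: eventually_sequentially)
  qed
  then show "(\<lambda>n. ?g n x) \<longlonglongrightarrow> step a b c x"
    by (rule tendsto_eventually)
qed

lemma isCont_step:
  assumes "x \<noteq> 0"
  shows "isCont (step a b c) x"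
proof -
  have "\<exists>v. \<forall>\<^sub>F y in nhds x. step a b c y = v"
  proof (cases "x < 0")
    case True
    have "\<forall>\<^sub>F y in nhds x. y < 0"
      using True eventually_nhds_in_open[of "{..<0}" x] by simp
    then show ?thesis
      by (intro exI[of _ a]) (auto simp: step_def elim: eventually_mono)
  next
    case False
    then have "\<forall>\<^sub>F y in nhds x. y > 0"
      using assms eventually_nhds_in_open[of "{0<..}" x] by simp
    then show ?thesis
      by (intro exI[of _ c]) (auto simp: step_def elim: eventually_mono)
  qed
  then obtain v where "\<forall>\<^sub>F y in nhds x. step a b c y = v" by blast
  then show ?thesis using isCont_cong[of "step a b c" "\<lambda>_. v" x] by simp
qed

lemma not_continuous_step:
  assumes "a \<noteq> b"
  shows "\<not> continuous_on UNIV (step a b c)"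
proof
  assume "continuous_on UNIV (step a b c)"
  then have "isCont (step a b c) 0"
    by (simp add: continuous_on_eq_continuous_at)
  then have "(step a b c \<longlongrightarrow> b) (at_left 0)"
    by (simp add: isCont_def filterlim_at_split step_def)
  moreover have "(step a b c \<longlongrightarrow> a) (at_left 0)"
    by (rule tendsto_eventually) (auto simp: eventually_at_filter step_def)
  ultimately show False
    using assms tendsto_unique trivial_limit_at_left_real by blast
qed

lemma graph_continuous_step: "graph_continuous (step a b a)"
  unfolding graph_continuous_def
proof (intro exI conjI)
  show "continuous_on UNIV (\<lambda>_::real. a)" by simp
  have "(x, a) \<in> closure (fun_graph (step a b a))" for x
  proof (cases "x = 0")
    case True
    have "(\<lambda>n. (inverse (real (Suc n)), a)) \<longlonglongrightarrow> (0, a)"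
      by (intro tendsto_Pair LIMSEQ_inverse_real_of_nat tendsto_const)
    moreover have "(inverse (real (Suc n)), a) \<in> fun_graph (step a b a)" for n
    proof -
      have "step a b a (inverse (real (Suc n))) = a"
        by (simp add: step_def)
      then show ?thesis unfolding fun_graph_def by force
    qed
    ultimately show ?thesis
      unfolding closure_sequential True
      by (intro exI[of _ "\<lambda>n. (inverse (real (Suc n)), a)"]) simp
  next
    case False
    then have "step a b a x = a" by (simp add: step_def)
    then have "(x, a) \<in> fun_graph (step a b a)" unfolding fun_graph_def by force
    then show ?thesis using closure_subset by blast
  qed
  then show "fun_graph (\<lambda>_. a) \<subseteq> closure (fun_graph (step a b a))"
    by (auto simp: fun_graph_def)
qed

lemma isCont_imp_symmetric_at:
  assumes "isCont f x"
  shows "symmetric_at f x"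
proof -
  have f: "(f \<longlongrightarrow> f x) (nhds x)"
    using assms by (simp add: isCont_def tendsto_at_iff_tendsto_nhds)
  have "((\<lambda>h. x + h) \<longlongrightarrow> x) (at 0)" "((\<lambda>h. x - h) \<longlongrightarrow> x) (at 0)"
    by (auto intro!: tendsto_eq_intros)
  then have "((\<lambda>h. f (x + h)) \<longlongrightarrow> f x) (at 0)" "((\<lambda>h. f (x - h)) \<longlongrightarrow> f x) (at 0)"
    by (auto intro: filterlim_compose[OF f])
  then show ?thesis
    unfolding symmetric_at_def by (auto intro!: tendsto_eq_intros)
qed

text \<open>
  At the origin the symmetric second difference has the constant value \<open>a + c - 2 b\<close> for all
  \<open>h \<noteq> 0\<close>, since exactly one of \<open>h\<close> and \<open>-h\<close> lies on each half line.
\<close>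

lemma symmetric_step:
  assumes "a + c = 2 * b"
  shows "symmetric_fun (step a b c)"
  unfolding symmetric_fun_def
proof
  fix x
  show "symmetric_at (step a b c) x"
  proof (cases "x = 0")
    case True
    have "\<forall>\<^sub>F h in at 0. step a b c (x + h) + step a b c (x - h) - 2 * step a b c x = 0"
      using assms True by (auto simp: eventually_at_filter step_def)
    then show ?thesis
      unfolding symmetric_at_def by (rule tendsto_eventually)
  next
    case False
    then show ?thesis by (intro isCont_imp_symmetric_at isCont_step)
  qed
qed

text \<open>
  Every point lies in the closure of one of the two open half lines, and the function takes its
  value at that point throughout this half line, so the preimage of any neighborhood contains it.
\<close>

lemma locally_almost_quasicontinuous_step: "locally_almost_quasicontinuous (step a b b)"
  unfolding locally_almost_quasicontinuous_def
proof (intro allI impI)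
  fix x V
  assume "step a b b x \<in> interior V"
  then have V: "step a b b x \<in> V" using interior_subset by blast
  define H where "H = (if x < 0 then {..<0::real} else {0<..})"
  have "open H" by (simp add: H_def)
  have "H \<subseteq> step a b b -` V"
    using V by (auto simp: H_def step_def split: if_splits)
  then have "H \<subseteq> interior (closure (step a b b -` V))"
    using \<open>open H\<close> closure_subset by (meson interior_maximal order_trans)
  moreover have "x \<in> closure H"
    by (simp add: H_def)
  ultimately show "x \<in> closure (interior (closure (step a b b -` V)))"
    by (meson closure_mono subsetD)
qed

theorem theorem4p1:
  shows "(\<exists>f :: real \<Rightarrow> real. baire_one f \<and> graph_continuous f \<and> \<not> continuous_on UNIV f) \<and>
         (\<exists>f :: real \<Rightarrow> real. baire_one f \<and> symmetric_fun f \<and> \<not> continuous_on UNIV f) \<and>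
         (\<exists>f :: real \<Rightarrow> real. baire_one f \<and> locally_almost_quasicontinuous f \<and> \<not> continuous_on UNIV f)"
proof (intro conjI)
  show "\<exists>f. baire_one f \<and> graph_continuous f \<and> \<not> continuous_on UNIV f"
    by (intro exI[of _ "step 0 1 0"] conjI baire_one_step graph_continuous_step
        not_continuous_step) simp
  show "\<exists>f. baire_one f \<and> symmetric_fun f \<and> \<not> continuous_on UNIV f"
    by (intro exI[of _ "step (-1) 0 1"] conjI baire_one_step symmetric_step
        not_continuous_step) simp_all
  show "\<exists>f. baire_one f \<and> locally_almost_quasicontinuous f \<and> \<not> continuous_on UNIV f"
    by (intro exI[of _ "step 0 1 1"] conjI baire_one_step locally_almost_quasicontinuous_step
        not_continuous_step) simp
qed

end
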